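(* Let $n,m\ge 1$, let $B_0$ be an $n\times n$ complex matrix, let $B_1,\dots,B_m$ be nonzero $n\times n$ complex matrices, let $\alpha_1,\dots,\alpha_m$ be nonzero complex numbers with $|\alpha_1|<|\alpha_2|<\cdots<|\alpha_m|$, and let $$T(\lambda)=-B_0+I\lambda+\frac{B_1}{\lambda-\alpha_1}+\cdots+\frac{B_m}{\lambda-\alpha_m}.$$ Let $\|\cdot\|$ be a matrix norm on $M_n(\mathbb{C})$ induced by a norm on $\mathbb{C}^n$. Suppose that $B_0$ is invertible and $$\|B_0^{-1}\|^{-1}>\frac{\|B_1\|}{|\alpha_1|}+\cdots+\frac{\|B_m\|}{|\alpha_m|}.$$ Then the real rational function $$p(x)=x-\|B_0^{-1}\|^{-1}-\frac{\|B_1\|}{x-|\alpha_1|}-\cdots-\frac{\|B_m\|}{x-|\alpha_m|}$$ has a unique positive root $\tilde R$ such that $\tilde R<|\alpha_i|$ for all $i=1,\dots,m$, and $\tilde R\le|\lambda_0|$ for any eigenvalue $\lambda_0$ of $T(\lambda)$.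
   Context: $I$ denotes the $n\times n$ identity matrix. A complex number $\lambda_0$ is an eigenvalue of the rational matrix $T(\lambda)$ if $T(\lambda_0)$ has finite entries and there is a nonzero $v\in\mathbb{C}^n$ with $T(\lambda_0)v=0$. A matrix norm is induced by a vector norm if it is the corresponding operator norm. *)

theory Defs
  imports "HOL-Complex_Analysis.Complex_Analysis"
begin

definition vector_norm :: "(complex^'n \<Rightarrow> real) \<Rightarrow> bool" where
  "vector_norm N \<longleftrightarrow>
     (\<forall>v. 0 \<le> N v) \<and>
     (\<forall>v. N v = 0 \<longleftrightarrow> v = 0) \<and>
     (\<forall>c v. N (c *s v) = cmod c * N v) \<and>
     (\<forall>v w. N (v + w) \<le> N v + N w)"

(* The library's onorm is tied to the type-class norm (Euclidean on complex^'n), whereas N is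
   arbitrary here.  The supremum is over a nonempty bounded set when N is a norm. *)
definition induced_norm :: "(complex^'n \<Rightarrow> real) \<Rightarrow> complex^'n^'n \<Rightarrow> real" where
  "induced_norm N A = (SUP v\<in>{v. v \<noteq> 0}. N (A *v v) / N v)"

(* "mat z" is z times the identity matrix. *)
definition rational_matrix ::
  "nat \<Rightarrow> complex^'n^'n \<Rightarrow> (nat \<Rightarrow> complex^'n^'n) \<Rightarrow> (nat \<Rightarrow> complex) \<Rightarrow> complex \<Rightarrow> complex^'n^'n"
where
  "rational_matrix m B0 B \<alpha> z =
     - B0 + mat z + (\<Sum>k=1..m. \<chi> i j. B k $ i $ j / (z - \<alpha> k))"

(* "T z0 has finite entries" means that no entry has a pole at z0; the values of T at poles, where
   HOL divides by zero, are thereby excluded.  T z0 is taken as it stands, so T must have no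
   removable singularities; for rational_matrix this holds when the residues B k are nonzero
   and the \<alpha> k distinct. *)
definition rational_eigenvalue :: "(complex \<Rightarrow> complex^'n^'n) \<Rightarrow> complex \<Rightarrow> bool" where
  "rational_eigenvalue T z0 \<longleftrightarrow>
     (\<forall>i j. \<not> is_pole (\<lambda>z. T z $ i $ j) z0) \<and> (\<exists>v. v \<noteq> 0 \<and> T z0 *v v = 0)"

definition bound_fun ::
  "(complex^'n \<Rightarrow> real) \<Rightarrow> nat \<Rightarrow> complex^'n^'n \<Rightarrow> (nat \<Rightarrow> complex^'n^'n) \<Rightarrow> (nat \<Rightarrow> complex) \<Rightarrow> real \<Rightarrow> real"
where
  "bound_fun N m B0 B \<alpha> x =
     x - inverse (induced_norm N (matrix_inv B0))
       - (\<Sum>k=1..m. induced_norm N (B k) / (x - cmod (\<alpha> k)))"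

end

theory Submission
  imports Defs
begin

text \<open>
  Write $c = \|B_0^{-1}\|^{-1}$, $b_k = \|B_k\|$ and $a_k = |\alpha_k|$. Left of all the poles $a_k$,
  every summand of $p(x) = x - c + \sum_k b_k/(a_k - x)$ is nondecreasing and the summand $x$ is
  strictly increasing, so $p$ has at most one root there. The hypothesis says exactly $p(0) < 0$;
  and because $b_1 > 0$, the single summand $b_1/(a_1 - x)$ already outweighs $c$ at
  $x = a_1 - b_1/c$, so the intermediate value theorem yields a root $R$ in $(0, a_1)$
  (\<open>pole_sum_root\<close>).

  Suppose $T(z)v = 0$ with $v \neq 0$ and $|z| < R$. Then $z$ lies strictly inside the circle
  through the nearest pole, and $B_0 v = zv + \sum_k B_k v/(z - \alpha_k)$. The left-hand side has
  norm at least $c\,N(v)$, because $v = B_0^{-1}(B_0 v)$; the right-hand side has norm at most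
  $(|z| + \sum_k b_k/(a_k - |z|))\,N(v)$. Hence $p(|z|) \geq 0 = p(R)$, which contradicts the
  monotonicity of $p$.

  The one analytic point is that the supremum defining the induced norm is over a bounded
  set, so that $N(Av) \leq \|A\|\,N(v)$; this is compactness of the unit sphere
  (\<open>induced_norm_bdd_above\<close>).
\<close>

section \<open>Induced matrix norms\<close>

lemma vector_normD:
  assumes "vector_norm N"
  shows vector_norm_nonneg: "0 \<le> N v"
    and vector_norm_eq_0_iff: "N v = 0 \<longleftrightarrow> v = 0"
    and vector_norm_scale: "N (c *s v) = cmod c * N v"
    and vector_norm_triangle: "N (v + w) \<le> N v + N w"
  using assms by (auto simp: vector_norm_def)

lemma vector_norm_pos: "vector_norm N \<Longrightarrow> v \<noteq> 0 \<Longrightarrow> 0 < N v"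
  using vector_norm_nonneg[of N v] vector_norm_eq_0_iff[of N v] by linarith

lemma vector_norm_scaleR:
  assumes "vector_norm N"
  shows "N (r *\<^sub>R v) = \<bar>r\<bar> * N v"
proof -
  have "r *\<^sub>R v = complex_of_real r *s v"
    by (simp add: vec_eq_iff scaleR_conv_of_real[where 'a = complex])
  then show ?thesis
    using vector_norm_scale[OF assms] by simp
qed

lemma vector_norm_sum:
  assumes "vector_norm N"
  shows "N (\<Sum>k\<in>K. f k) \<le> (\<Sum>k\<in>K. N (f k))"
proof (induction K rule: infinite_finite_induct)
  case (insert k K)
  then show ?case
    using vector_norm_triangle[OF assms, of "f k" "sum f K"] by simp
qed (simp_all add: vector_norm_eq_0_iff[OF assms, THEN iffD2])

text \<open>A norm is convex, and convex functions on a finite-dimensional space are continuous.\<close>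

lemma continuous_on_vector_norm:
  fixes N :: "complex^'n \<Rightarrow> real"
  assumes "vector_norm N"
  shows "continuous_on UNIV N"
proof (rule convex_on_continuous)
  show "convex_on UNIV N"
  proof (rule convex_onI)
    fix t :: real and x y :: "complex^'n"
    assume "0 < t" "t < 1"
    then show "N ((1 - t) *\<^sub>R x + t *\<^sub>R y) \<le> (1 - t) * N x + t * N y"
      using vector_norm_triangle[OF assms, of "(1 - t) *\<^sub>R x" "t *\<^sub>R y"]
      by (simp add: vector_norm_scaleR[OF assms])
  qed simp
qed simp

lemma matrix_vector_mult_scaleR_complex:
  fixes A :: "complex^'n^'m"
  shows "A *v (r *\<^sub>R v) = r *\<^sub>R (A *v v)"
  by (simp add: matrix_vector_mult_def vec_eq_iff scaleR_sum_right)

text \<open>The quotient is invariant under scaling of \<open>v\<close>, hence takes all its values on the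
  Euclidean unit sphere, where it is continuous.\<close>

lemma induced_norm_bdd_above:
  fixes A :: "complex^'n^'n"
  assumes "vector_norm N"
  shows "bdd_above ((\<lambda>v. N (A *v v) / N v) ` {v. v \<noteq> 0})"
proof -
  let ?q = "\<lambda>v. N (A *v v) / N v"
  have contA: "continuous_on (sphere 0 1) ((*v) A)"
    unfolding matrix_vector_mult_def by (intro continuous_intros)
  have "continuous_on (sphere 0 1) ?q"
    using continuous_on_compose2[OF continuous_on_vector_norm[OF assms] contA]
      continuous_on_subset[OF continuous_on_vector_norm[OF assms]]
    by (intro continuous_on_divide) (auto simp: vector_norm_eq_0_iff[OF assms])
  then have "compact (?q ` sphere 0 1)"
    by (intro compact_continuous_image) auto
  then have bdd: "bdd_above (?q ` sphere 0 1)"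
    by (intro bounded_imp_bdd_above compact_imp_bounded)
  have "?q v \<in> ?q ` sphere 0 1" if "v \<noteq> 0" for v
  proof (rule image_eqI)
    show "inverse (norm v) *\<^sub>R v \<in> sphere 0 1"
      using that by simp
    show "?q v = ?q (inverse (norm v) *\<^sub>R v)"
      using that by (simp add: matrix_vector_mult_scaleR_complex vector_norm_scaleR[OF assms])
  qed
  then have "?q ` {v. v \<noteq> 0} \<subseteq> ?q ` sphere 0 1"
    by blast
  then show ?thesis
    by (rule bdd_above_mono[OF bdd])
qed

lemma induced_norm_bound:
  fixes A :: "complex^'n^'n"
  assumes "vector_norm N"
  shows "N (A *v v) \<le> induced_norm N A * N v"
proof (cases "v = 0")
  case True
  then show ?thesis
    using vector_norm_eq_0_iff[OF assms, of 0] by simp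
next
  case False
  have "N (A *v v) / N v \<le> induced_norm N A"
    unfolding induced_norm_def
    using False by (intro cSUP_upper induced_norm_bdd_above assms) simp
  then show ?thesis
    using vector_norm_pos[OF assms False] by (simp add: field_simps)
qed

lemma induced_norm_nonneg:
  fixes A :: "complex^'n^'n"
  assumes "vector_norm N"
  shows "0 \<le> induced_norm N A"
proof -
  have "0 \<le> induced_norm N A * N (axis undefined 1)"
    using induced_norm_bound[OF assms] vector_norm_nonneg[OF assms] order_trans by blast
  moreover have "0 < N (axis undefined 1)"
    by (rule vector_norm_pos[OF assms]) (simp add: axis_eq_0_iff)
  ultimately show ?thesis
    by (simp add: zero_le_mult_iff)
qed

lemma induced_norm_pos:
  fixes A :: "complex^'n^'n"
  assumes "vector_norm N" and "A \<noteq> 0"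
  shows "0 < induced_norm N A"
proof -
  obtain v where "A *v v \<noteq> 0"
    using assms(2) matrix_eq[of A 0] by auto
  then have "0 < induced_norm N A * N v"
    using vector_norm_pos[OF assms(1)] induced_norm_bound[OF assms(1)] less_le_trans by blast
  then show ?thesis
    using induced_norm_nonneg[OF assms(1), of A] by (simp add: zero_less_mult_iff)
qed

lemma invertible_lower_bound:
  fixes A :: "complex^'n^'n"
  assumes "vector_norm N" and "invertible A"
    and "0 < induced_norm N (matrix_inv A)"
  shows "inverse (induced_norm N (matrix_inv A)) * N v \<le> N (A *v v)"
proof -
  have "matrix_inv A ** A = mat 1"
    using assms(2) unfolding invertible_def matrix_inv_def by (metis (mono_tags, lifting) someI_ex)
  then have "matrix_inv A *v (A *v v) = v"
    by (simp add: matrix_vector_mul_assoc)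
  then have "N v \<le> induced_norm N (matrix_inv A) * N (A *v v)"
    using induced_norm_bound[OF assms(1), of "matrix_inv A" "A *v v"] by simp
  then show ?thesis
    using assms(3) by (simp add: field_simps)
qed

section \<open>The scalar function left of its poles\<close>

lemma pole_sum_strict_mono:
  fixes a b :: "'k \<Rightarrow> real"
  assumes "\<And>k. k \<in> K \<Longrightarrow> 0 \<le> b k" and "\<And>k. k \<in> K \<Longrightarrow> y < a k" and "x < y"
  shows "x - c - (\<Sum>k\<in>K. b k / (x - a k)) < y - c - (\<Sum>k\<in>K. b k / (y - a k))"
proof -
  have "(\<Sum>k\<in>K. b k / (y - a k)) \<le> (\<Sum>k\<in>K. b k / (x - a k))"
  proof (rule sum_mono)
    fix k assume "k \<in> K"
    then have "0 \<le> b k" "y < a k"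
      using assms by auto
    then have "b k / (a k - x) \<le> b k / (a k - y)"
      using assms(3) by (intro divide_left_mono) auto
    then show "b k / (y - a k) \<le> b k / (x - a k)"
      using minus_divide_right[of "b k" "a k - x"] minus_divide_right[of "b k" "a k - y"] by simp
  qed
  then show ?thesis
    using assms(3) by linarith
qed

text \<open>At \<open>0\<close> the value is negative by assumption, and at \<open>a j - b j / c\<close> the term of index \<open>j\<close>
  equals \<open>c\<close>, which leaves a positive value.\<close>

lemma pole_sum_root:
  fixes a b :: "'k \<Rightarrow> real"
  assumes "finite K" and "j \<in> K" and "0 < b j"
    and b: "\<And>k. k \<in> K \<Longrightarrow> 0 \<le> b k"
    and a: "0 < a j" "\<And>k. k \<in> K \<Longrightarrow> a j \<le> a k"
    and c: "(\<Sum>k\<in>K. b k / a k) < c"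
  obtains R where "0 < R" and "R < a j" and "R - c - (\<Sum>k\<in>K. b k / (R - a k)) = 0"
proof -
  let ?p = "\<lambda>x. x - c - (\<Sum>k\<in>K. b k / (x - a k))"
  let ?x = "a j - b j / c"
  have pos: "0 < a k" if "k \<in> K" for k
    using a that less_le_trans by blast
  have "b j / a j \<le> (\<Sum>k\<in>K. b k / a k)"
    using assms(1,2) b pos by (intro member_le_sum) (auto simp: less_imp_le)
  then have c': "b j / a j < c"
    using c by linarith
  moreover have "0 < b j / a j"
    using assms(3) a(1) by simp
  ultimately have "0 < c"
    by linarith
  have x: "0 < ?x" "?x < a j"
    using c' \<open>0 < c\<close> assms(3) a(1) by (simp_all add: field_simps)
  have p0: "?p 0 < 0"
    using c by (simp add: sum_negf)
  have "(\<Sum>k\<in>K - {j}. b k / (?x - a k)) \<le> 0"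
  proof (rule sum_nonpos)
    fix k assume "k \<in> K - {j}"
    then show "b k / (?x - a k) \<le> 0"
      using b[of k] a(2)[of k] x(2) by (intro divide_nonneg_nonpos) auto
  qed
  then have "(\<Sum>k\<in>K. b k / (?x - a k)) \<le> b j / (?x - a j)"
    by (simp only: sum.remove[OF assms(1,2)] add_le_same_cancel1)
  also have "\<dots> = - c"
    using \<open>0 < c\<close> assms(3) by simp
  finally have px: "0 < ?p ?x"
    using x(1) by linarith
  have "continuous_on {0..?x} ?p"
    using a(2) x(2) by (intro continuous_intros) fastforce+
  then obtain R where R: "0 \<le> R" "R \<le> ?x" "?p R = 0"
    using IVT'[of ?p 0 0 ?x] p0 px x(1) by auto
  moreover have "R \<noteq> 0"
    using R(3) p0 by force
  ultimately show thesis
    using that x(2) by (metis order_le_less order_le_less_trans)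
qed

section \<open>Null vectors of the rational matrix\<close>

lemma rational_matrix_mult_vec:
  fixes B0 :: "complex^'n^'n"
  shows "rational_matrix m B0 B \<alpha> z *v v =
     z *s v - B0 *v v + (\<Sum>k=1..m. (1 / (z - \<alpha> k)) *s (B k *v v))"
proof -
  have entry: "(\<chi> i j. A $ i $ j / d) *v v = (1 / d) *s (A *v v)" for A :: "complex^'n^'n" and d
    by (simp add: matrix_vector_mult_def vec_eq_iff sum_divide_distrib)
  have "(\<Sum>k\<in>K. F k) *v v = (\<Sum>k\<in>K. F k *v v)" for K and F :: "nat \<Rightarrow> complex^'n^'n"
    by (induction K rule: infinite_finite_induct)
       (simp_all add: matrix_vector_mult_add_rdistrib)
  moreover have "mat z *v v = z *s v"
    by (simp add: matrix_vector_mult_def mat_def vec_eq_iff if_distrib[where f = "\<lambda>x. x * _"]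
        cong: if_cong)
  ultimately show ?thesis
    by (simp add: rational_matrix_def matrix_vector_mult_add_rdistrib matrix_vector_mult_diff_rdistrib entry)
qed

text \<open>Comparing the norms of the two sides of $B_0 v = zv + \sum_k B_k v/(z - \alpha_k)$, where
  $|z - \alpha_k| \geq |\alpha_k| - |z| > 0$.\<close>

lemma bound_fun_nonneg_at_null_vector:
  fixes B0 :: "complex^'n^'n"
  assumes N: "vector_norm N" and inv: "invertible B0" "0 < induced_norm N (matrix_inv B0)"
    and z: "\<And>k. k \<in> {1..m} \<Longrightarrow> cmod z < cmod (\<alpha> k)"
    and v: "v \<noteq> 0" "rational_matrix m B0 B \<alpha> z *v v = 0"
  shows "0 \<le> bound_fun N m B0 B \<alpha> (cmod z)"
proof -
  let ?S = "\<Sum>k=1..m. (1 / (z - \<alpha> k)) *s (B k *v v)"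
  let ?c = "inverse (induced_norm N (matrix_inv B0))"
  let ?s = "\<Sum>k=1..m. induced_norm N (B k) / (cmod z - cmod (\<alpha> k))"
  have summand: "N ((1 / (z - \<alpha> k)) *s (B k *v v))
      \<le> - (induced_norm N (B k) / (cmod z - cmod (\<alpha> k))) * N v" if "k \<in> {1..m}" for k
  proof -
    have gap: "0 < cmod (\<alpha> k) - cmod z"
      using z[OF that] by simp
    have dist: "cmod (\<alpha> k) - cmod z \<le> cmod (z - \<alpha> k)"
      using norm_triangle_ineq2[of "\<alpha> k" z] by (simp add: norm_minus_commute)
    have "N ((1 / (z - \<alpha> k)) *s (B k *v v)) = N (B k *v v) / cmod (z - \<alpha> k)"
      by (simp add: vector_norm_scale[OF N] norm_divide)
    also have "\<dots> \<le> induced_norm N (B k) * N v / (cmod (\<alpha> k) - cmod z)"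
      using gap dist induced_norm_bound[OF N] induced_norm_nonneg[OF N] vector_norm_nonneg[OF N]
      by (intro frac_le) auto
    also have "\<dots> = - (induced_norm N (B k) / (cmod z - cmod (\<alpha> k))) * N v"
      using minus_divide_right[of "induced_norm N (B k)" "cmod z - cmod (\<alpha> k)"] by simp
    finally show ?thesis .
  qed
  have "N ?S \<le> (\<Sum>k=1..m. N ((1 / (z - \<alpha> k)) *s (B k *v v)))"
    by (rule vector_norm_sum[OF N])
  also have "\<dots> \<le> (\<Sum>k=1..m. - (induced_norm N (B k) / (cmod z - cmod (\<alpha> k))) * N v)"
    using summand by (rule sum_mono)
  also have "\<dots> = - ?s * N v"
    by (simp only: sum_distrib_right[symmetric] sum_negf)
  finally have S: "N ?S \<le> - ?s * N v" .
  have "B0 *v v = z *s v + ?S"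
    using v(2) by (simp add: rational_matrix_mult_vec algebra_simps)
  then have "?c * N v \<le> N (z *s v + ?S)"
    using invertible_lower_bound[OF N inv, of v] by simp
  also have "\<dots> \<le> cmod z * N v + N ?S"
    using vector_norm_triangle[OF N, of "z *s v" ?S] by (simp add: vector_norm_scale[OF N])
  also have "\<dots> \<le> (cmod z - ?s) * N v"
    using S by (simp add: left_diff_distrib)
  finally have "?c \<le> cmod z - ?s"
    using vector_norm_pos[OF N v(1)] by simp
  then show ?thesis
    by (simp add: bound_fun_def)
qed

section \<open>The eigenvalue bound\<close>

theorem theorem2p8:
  fixes B0 :: "complex^'n^'n" and B :: "nat \<Rightarrow> complex^'n^'n"
    and \<alpha> :: "nat \<Rightarrow> complex" and m :: nat and N :: "complex^'n \<Rightarrow> real"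
  assumes "m \<ge> 1"
    and "\<And>k. k \<in> {1..m} \<Longrightarrow> B k \<noteq> 0"
    and "\<And>k. k \<in> {1..m} \<Longrightarrow> \<alpha> k \<noteq> 0"
    and "strict_mono_on {1..m} (\<lambda>k. cmod (\<alpha> k))"
    and "vector_norm N"
    and "invertible B0"
    and "inverse (induced_norm N (matrix_inv B0)) > (\<Sum>k=1..m. induced_norm N (B k) / cmod (\<alpha> k))"
  shows "\<exists>R. (0 < R \<and> bound_fun N m B0 B \<alpha> R = 0 \<and> (\<forall>k\<in>{1..m}. R < cmod (\<alpha> k))) \<and>
             (\<forall>R'. 0 < R' \<and> bound_fun N m B0 B \<alpha> R' = 0 \<and> (\<forall>k\<in>{1..m}. R' < cmod (\<alpha> k)) \<longrightarrow> R' = R) \<and>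
             (\<forall>z0. rational_eigenvalue (rational_matrix m B0 B \<alpha>) z0 \<longrightarrow> R \<le> cmod z0)"
proof -
  let ?p = "bound_fun N m B0 B \<alpha>"
  let ?c = "inverse (induced_norm N (matrix_inv B0))"
  note N = assms(5)
  have b: "0 \<le> induced_norm N (B k)" for k
    by (rule induced_norm_nonneg[OF N])
  have "0 \<le> (\<Sum>k=1..m. induced_norm N (B k) / cmod (\<alpha> k))"
    using b by (intro sum_nonneg) auto
  \<comment> \<open>Since \<open>inverse 0 = 0\<close>, the positivity of \<open>?c\<close> also rules out a vanishing norm of the
    inverse matrix.\<close>
  with assms(7) have "0 < ?c"
    by linarith
  then have inv_pos: "0 < induced_norm N (matrix_inv B0)"
    by simp
  have nearest: "cmod (\<alpha> 1) \<le> cmod (\<alpha> k)" if "k \<in> {1..m}" for k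
    using strict_mono_on_leD[OF assms(4), of 1 k] that by simp
  have mono: "?p x < ?p y" if "x < y" "\<forall>k\<in>{1..m}. y < cmod (\<alpha> k)" for x y
    unfolding bound_fun_def using that b by (intro pole_sum_strict_mono) auto
  obtain R where "0 < R" "R < cmod (\<alpha> 1)" and
    "R - ?c - (\<Sum>k=1..m. induced_norm N (B k) / (R - cmod (\<alpha> k))) = 0"
    using assms(1) nearest b induced_norm_pos[OF N assms(2)[of 1]] assms(3)[of 1] assms(7)
    by (rule_tac pole_sum_root[where K = "{1..m}" and j = 1 and a = "\<lambda>k. cmod (\<alpha> k)"
          and b = "\<lambda>k. induced_norm N (B k)" and c = "?c"]) auto
  then have R: "0 < R" "?p R = 0" "\<forall>k\<in>{1..m}. R < cmod (\<alpha> k)"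
    using nearest by (auto simp: bound_fun_def intro: less_le_trans)
  show ?thesis
  proof (intro exI[of _ R] conjI allI impI)
    fix R' assume R': "0 < R' \<and> ?p R' = 0 \<and> (\<forall>k\<in>{1..m}. R' < cmod (\<alpha> k))"
    show "R' = R"
      using mono[of R R'] mono[of R' R] R R' by (cases R R' rule: linorder_cases) auto
  next
    fix z0 assume "rational_eigenvalue (rational_matrix m B0 B \<alpha>) z0"
    then obtain v where v: "v \<noteq> 0" "rational_matrix m B0 B \<alpha> z0 *v v = 0"
      by (auto simp: rational_eigenvalue_def)
    show "R \<le> cmod z0"
    proof (rule ccontr)
      assume "\<not> R \<le> cmod z0"
      then have less: "cmod z0 < R"
        by simp
      then have "0 \<le> ?p (cmod z0)"
        using R(3) by (intro bound_fun_nonneg_at_null_vector[OF N assms(6) inv_pos _ v]) force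
      then show False
        using mono[OF less R(3)] R(2) by linarith
    qed
  qed (use R in auto)
qed

end
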